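(* Let $\varphi\in D^{0,1}[0,1]$, and let $\varphi_1,\varphi_2:[0,1]\to[0,1]$ be functions belonging to $H_1[0,1]$ with $\varphi_1(1)=1$ and $\varphi_2(0)=0$. Let $T$ be the operator defined on $D^{0,1}[0,1]$ by $$(Tf)(x)=\varphi(x)f(\varphi_1(x))+(1-\varphi(x))f(\varphi_2(x)),\qquad x\in[0,1].$$ If $$\|\varphi\|\left(\|\varphi_1\|-\varphi_1(0)+\|\varphi_2\|\right)<\frac12,$$ then $T$ has a unique fixed point $f^\star$ in $D^{0,1}[0,1]$. Furthermore, for an arbitrary $f^0\in D^{0,1}[0,1]$, the sequence $(f^n)$ in $D^{0,1}[0,1]$ defined by $$f^n(x)=\varphi(x)f^{n-1}(\varphi_1(x))+(1-\varphi(x))f^{n-1}(\varphi_2(x)),\qquad x\in[0,1],\ n\in\mathbb{N},\ n\ge 1,$$ converges in the metric $d$ to the unique fixed point $f^\star$ of $T$.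
   Context: $H_1[0,1]$ denotes the space of (Lipschitz) functions $f:[0,1]\to\mathbb{R}$ such that $\sup\left\{\frac{|f(x)-f(y)|}{|x-y|}: x,y\in[0,1],\ x\ne y\right\}<\infty$, equipped with the norm $$\|f\|=|f(0)|+\sup\left\{\frac{|f(x)-f(y)|}{|x-y|}: x,y\in[0,1],\ x\ne y\right\}.$$ The subset $D^{0,1}[0,1]=\{f\in H_1[0,1]: f(0)=0,\ f(1)=1\}$ is equipped with the metric $d(f,g)=\|f-g\|$. The superscript in $f^n$ is an iteration index, not a power. *)

theory Defs
  imports Complex_Main "HOL-Library.FuncSet"
begin

text \<open>
  A function on \<open>[0,1]\<close> is represented by a total function that takes the value
  \<open>undefined\<close> outside of \<open>{0..1}\<close> (\<open>extensional\<close>), so that HOL equality of such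
  functions is equality on \<open>[0,1]\<close>.
\<close>

definition diff_quotients :: "(real \<Rightarrow> real) \<Rightarrow> real set" where
  "diff_quotients f = {\<bar>f x - f y\<bar> / \<bar>x - y\<bar> | x y. x \<in> {0..1} \<and> y \<in> {0..1} \<and> x \<noteq> y}"

definition H1 :: "(real \<Rightarrow> real) set" where
  "H1 = {f \<in> extensional {0..1}. bdd_above (diff_quotients f)}"

text \<open>
  The supremum is one of reals; it is only meaningful for a bounded set of
  difference quotients, hence for functions in \<open>H1\<close>.
\<close>

definition H1_norm :: "(real \<Rightarrow> real) \<Rightarrow> real" where
  "H1_norm f = \<bar>f 0\<bar> + Sup (diff_quotients f)"

definition H1_dist :: "(real \<Rightarrow> real) \<Rightarrow> (real \<Rightarrow> real) \<Rightarrow> real" where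
  "H1_dist f g = H1_norm (\<lambda>x\<in>{0..1}. f x - g x)"

definition D01 :: "(real \<Rightarrow> real) set" where
  "D01 = {f \<in> H1. f 0 = 0 \<and> f 1 = 1}"

definition T_op ::
  "(real \<Rightarrow> real) \<Rightarrow> (real \<Rightarrow> real) \<Rightarrow> (real \<Rightarrow> real) \<Rightarrow> (real \<Rightarrow> real) \<Rightarrow> real \<Rightarrow> real" where
  "T_op \<phi> \<phi>1 \<phi>2 f = (\<lambda>x\<in>{0..1}. \<phi> x * f (\<phi>1 x) + (1 - \<phi> x) * f (\<phi>2 x))"

end

theory Submission
  imports Defs "HOL-Analysis.Lipschitz"
begin

text \<open>
  On differences \<open>g\<close> of elements of \<open>D01\<close>, which vanish at both end points, the norm is the
  least Lipschitz constant, and \<open>T\<close> acts linearly. Let \<open>K\<close>, \<open>L1\<close>, \<open>L2\<close> be Lipschitz constants of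
  \<open>\<phi>\<close>, \<open>\<phi>1\<close>, \<open>\<phi>2\<close>. Since \<open>\<bar>\<phi>\<bar> \<le> K\<close> and \<open>\<bar>1 - \<phi>\<bar> \<le> K\<close>, the product rule leaves, besides two terms
  bounded by \<open>K L1\<close> and \<open>K L2\<close> times the constant of \<open>g\<close>, the terms \<open>g (\<phi>1 y)\<close> and \<open>g (\<phi>2 y)\<close>.
  As \<open>g (\<phi>1 1) = 0\<close> and \<open>g (\<phi>2 0) = 0\<close>, these are bounded by \<open>L1\<close> and \<open>L2\<close> times the constant of
  \<open>g\<close>. So \<open>T\<close> contracts Lipschitz constants by \<open>2 K (L1 + L2) < 1\<close>, and Banach's argument applies.
\<close>

section \<open>The norm of \<open>H1\<close> in terms of Lipschitz constants\<close>

lemma diff_quotients_nonempty: "diff_quotients f \<noteq> {}"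
proof -
  have "\<bar>f 0 - f 1\<bar> / \<bar>0 - 1\<bar> \<in> diff_quotients f"
    unfolding diff_quotients_def by (rule CollectI, rule exI[of _ 0], rule exI[of _ 1]) simp
  then show ?thesis by blast
qed

lemma H1_lipschitz_on:
  assumes "f \<in> H1"
  shows "(Sup (diff_quotients f))-lipschitz_on {0..1} f"
proof (rule lipschitz_onI)
  have bdd: "bdd_above (diff_quotients f)"
    using assms by (simp add: H1_def)
  \<comment> \<open>\<open>lipschitz_on\<close> demands a nonnegative constant; any one quotient,
    being nonnegative, provides this for the supremum.\<close>
  obtain q where q: "q \<in> diff_quotients f"
    using diff_quotients_nonempty by blast
  then have "0 \<le> q"
    by (auto simp: diff_quotients_def)
  then show "0 \<le> Sup (diff_quotients f)"
    using cSup_upper[OF q bdd] by linarith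
  show "dist (f x) (f y) \<le> Sup (diff_quotients f) * dist x y"
    if "x \<in> {0..1}" "y \<in> {0..1}" for x y
  proof (cases "x = y")
    case False
    then have "\<bar>f x - f y\<bar> / \<bar>x - y\<bar> \<in> diff_quotients f"
      using that by (auto simp: diff_quotients_def)
    then have "\<bar>f x - f y\<bar> / \<bar>x - y\<bar> \<le> Sup (diff_quotients f)"
      using bdd by (rule cSup_upper)
    then show ?thesis
      using False by (simp add: dist_real_def divide_le_eq)
  qed simp
qed

lemma diff_quotients_le:
  assumes "L-lipschitz_on {0..1} f" and "q \<in> diff_quotients f"
  shows "q \<le> L"
  using assms(2) lipschitz_onD[OF assms(1)]
  by (auto simp: diff_quotients_def dist_real_def divide_le_eq)

lemma lipschitz_on_H1:
  assumes "L-lipschitz_on {0..1} f" and "f \<in> extensional {0..1}"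
  shows "f \<in> H1"
  using assms diff_quotients_le[OF assms(1)] by (auto simp: H1_def bdd_above_def)

lemma lipschitz_on_restrict:
  "L-lipschitz_on A (restrict f A) \<longleftrightarrow> L-lipschitz_on A f"
  by (simp add: lipschitz_on_def)

text \<open>The Lipschitz hypothesis makes the supremum one over a bounded set. This is the lower
  half of the sandwich that proves convergence in the metric.\<close>

lemma H1_dist_nonneg:
  assumes "L-lipschitz_on {0..1} (\<lambda>x. f x - g x)"
  shows "0 \<le> H1_dist f g"
proof -
  have "restrict (\<lambda>x. f x - g x) {0..1} \<in> H1"
    using assms by (intro lipschitz_on_H1[of L]) (simp_all only: lipschitz_on_restrict restrict_extensional)
  then show ?thesis
    unfolding H1_dist_def H1_norm_def
    using H1_lipschitz_on lipschitz_on_nonneg by fastforce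
qed

text \<open>Agreement at 0 removes the point term of the norm, so metric estimates reduce to
  Lipschitz constants of differences.\<close>

lemma H1_dist_le:
  assumes "L-lipschitz_on {0..1} (\<lambda>x. f x - g x)" and "f 0 = g 0"
  shows "H1_dist f g \<le> L"
proof -
  have "L-lipschitz_on {0..1} (restrict (\<lambda>x. f x - g x) {0..1})"
    using assms(1) by (simp only: lipschitz_on_restrict)
  from cSup_least[OF diff_quotients_nonempty diff_quotients_le[OF this]]
  show ?thesis
    using assms(2) by (simp add: H1_dist_def H1_norm_def)
qed

lemma D01_iff_lipschitz_on:
  "f \<in> D01 \<longleftrightarrow> f \<in> extensional {0..1} \<and> (\<exists>L. L-lipschitz_on {0..1} f) \<and> f 0 = 0 \<and> f 1 = 1"
proof -
  have "f \<in> H1 \<longleftrightarrow> f \<in> extensional {0..1} \<and> (\<exists>L. L-lipschitz_on {0..1} f)"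
  proof
    assume "f \<in> H1"
    then show "f \<in> extensional {0..1} \<and> (\<exists>L. L-lipschitz_on {0..1} f)"
      using H1_lipschitz_on[of f] by (auto simp: H1_def)
  qed (blast intro: lipschitz_on_H1)
  then show ?thesis
    by (auto simp: D01_def)
qed

lemma D01_diff_lipschitz_on:
  assumes "f \<in> D01" "g \<in> D01"
  obtains M where "M-lipschitz_on {0..1} (\<lambda>x. f x - g x)"
  using assms lipschitz_on_diff unfolding D01_iff_lipschitz_on by blast

text \<open>No point of the unit interval is further than 1 from the zero \<open>a\<close>.\<close>

lemma lipschitz_on_abs_le:
  fixes g :: "real \<Rightarrow> real"
  assumes "M-lipschitz_on {0..1} g" and "a \<in> {0..1}" and "g a = 0" and "x \<in> {0..1}"
  shows "\<bar>g x\<bar> \<le> M"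
proof -
  have "\<bar>g x\<bar> \<le> M * \<bar>x - a\<bar>"
    using lipschitz_onD[OF assms(1,4,2)] assms(3) by (simp add: dist_real_def)
  also have "\<dots> \<le> M * 1"
    using assms lipschitz_on_nonneg by (intro mult_left_mono) auto
  finally show ?thesis by simp
qed

text \<open>The constant is the same for all \<open>n\<close>, so each inequality between two fixed
  points survives the pointwise limit.\<close>

lemma lipschitz_on_LIMSEQ:
  fixes F :: "'a::metric_space \<Rightarrow> 'b::metric_space"
  assumes "\<And>n. L-lipschitz_on A (f n)" and "\<And>x. x \<in> A \<Longrightarrow> (\<lambda>n. f n x) \<longlonglongrightarrow> F x"
  shows "L-lipschitz_on A F"
proof (rule lipschitz_onI)
  show "0 \<le> L"
    using assms(1) lipschitz_on_nonneg by blast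
  show "dist (F x) (F y) \<le> L * dist x y" if "x \<in> A" "y \<in> A" for x y
  proof (rule LIMSEQ_le_const2)
    show "(\<lambda>n. dist (f n x) (f n y)) \<longlonglongrightarrow> dist (F x) (F y)"
      using assms(2) that by (intro tendsto_dist)
    show "\<exists>N. \<forall>n\<ge>N. dist (f n x) (f n y) \<le> L * dist x y"
      using lipschitz_onD[OF assms(1)] that by blast
  qed
qed

section \<open>The operator \<open>T\<close> on Lipschitz functions\<close>

locale averaging_operator =
  fixes \<phi> \<phi>1 \<phi>2 :: "real \<Rightarrow> real" and K L1 L2 :: real
  assumes lip: "K-lipschitz_on {0..1} \<phi>" "L1-lipschitz_on {0..1} \<phi>1" "L2-lipschitz_on {0..1} \<phi>2"
    and phi_ends [simp]: "\<phi> 0 = 0" "\<phi> 1 = 1" "\<phi>1 1 = 1" "\<phi>2 0 = 0"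
    and maps: "\<phi>1 \<in> {0..1} \<rightarrow> {0..1}" "\<phi>2 \<in> {0..1} \<rightarrow> {0..1}"
    and small: "K * (L1 + L2) < 1 / 2"
begin

abbreviation T where "T \<equiv> T_op \<phi> \<phi>1 \<phi>2"

text \<open>The contraction factor. The 2 arises because the product rule yields each of
  \<open>K * L1\<close> and \<open>K * L2\<close> twice.\<close>

definition q where "q = 2 * K * (L1 + L2)"

lemma q_bounds: "0 \<le> q" "q < 1"
  using small lip[THEN lipschitz_on_nonneg] by (auto simp: q_def)

lemma T_ext [simp]: "T f \<in> extensional {0..1}"
  by (simp add: T_op_def)

lemma T_diff: "x \<in> {0..1} \<Longrightarrow> T f x - T g x = T (\<lambda>x. f x - g x) x"
  by (simp add: T_op_def algebra_simps)

text \<open>At 0 only the term with \<phi>2 has weight, at 1 only the one with \<phi>1, and these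
  maps fix the respective end point.\<close>

lemma T_ends [simp]: "T f 0 = f 0" "T f 1 = f 1"
  by (simp_all add: T_op_def)

lemma phi_bounds:
  assumes "x \<in> {0..1}"
  shows "\<bar>\<phi> x\<bar> \<le> K" "\<bar>1 - \<phi> x\<bar> \<le> K"
proof -
  show "\<bar>\<phi> x\<bar> \<le> K"
    using lip(1) assms by (intro lipschitz_on_abs_le[of _ _ 0]) auto
  have "K-lipschitz_on {0..1} (\<lambda>x. 1 - \<phi> x)"
    using lip(1) by (simp add: lipschitz_on_def dist_real_def abs_minus_commute)
  then show "\<bar>1 - \<phi> x\<bar> \<le> K"
    using assms by (intro lipschitz_on_abs_le[of _ "\<lambda>x. 1 - \<phi> x" 1]) auto
qed

text \<open>Stated for arbitrary \<open>g1\<close> and \<open>g2\<close>, with \<open>M1\<close> and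
  \<open>M2\<close> bounding both slopes and values, so that it serves the contraction estimate as
  well as the invariance of \<open>D01\<close>.\<close>

lemma averaging_lipschitz_on:
  assumes g1: "M1-lipschitz_on {0..1} g1" and g2: "M2-lipschitz_on {0..1} g2"
    and b1: "\<And>x. x \<in> {0..1} \<Longrightarrow> \<bar>g1 x\<bar> \<le> M1" and b2: "\<And>x. x \<in> {0..1} \<Longrightarrow> \<bar>g2 x\<bar> \<le> M2"
  shows "(2 * K * (M1 + M2))-lipschitz_on {0..1} (\<lambda>x. \<phi> x * g1 x + (1 - \<phi> x) * g2 x)"
proof (rule lipschitz_onI)
  have nonneg: "0 \<le> K" "0 \<le> M1" "0 \<le> M2"
    using lip(1) g1 g2 lipschitz_on_nonneg by blast+
  then show "0 \<le> 2 * K * (M1 + M2)"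
    by simp
  fix x y :: real
  assume x: "x \<in> {0..1}" and y: "y \<in> {0..1}"
  have *: "\<bar>a * b\<bar> \<le> A * B" if "\<bar>a\<bar> \<le> A" "\<bar>b\<bar> \<le> B" for a b A B :: real
    unfolding abs_mult using that by (intro mult_mono) auto
  have lips: "\<bar>\<phi> x - \<phi> y\<bar> \<le> K * \<bar>x - y\<bar>" "\<bar>g1 x - g1 y\<bar> \<le> M1 * \<bar>x - y\<bar>"
      "\<bar>g2 x - g2 y\<bar> \<le> M2 * \<bar>x - y\<bar>"
    using lipschitz_onD[OF lip(1) x y] lipschitz_onD[OF g1 x y] lipschitz_onD[OF g2 x y]
    by (simp_all add: dist_real_def)
  have "\<bar>\<phi> x * (g1 x - g1 y)\<bar> \<le> K * (M1 * \<bar>x - y\<bar>)"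
      "\<bar>(\<phi> x - \<phi> y) * g1 y\<bar> \<le> K * \<bar>x - y\<bar> * M1"
      "\<bar>(1 - \<phi> x) * (g2 x - g2 y)\<bar> \<le> K * (M2 * \<bar>x - y\<bar>)"
      "\<bar>(\<phi> x - \<phi> y) * g2 y\<bar> \<le> K * \<bar>x - y\<bar> * M2"
    using phi_bounds[OF x] b1[OF y] b2[OF y] lips by - (rule *; assumption)+
  \<comment> \<open>Product rule for differences; the last sign is negative because the weights
    \<open>\<phi>\<close> and \<open>1 - \<phi>\<close> have opposite increments.\<close>
  moreover have "\<phi> x * g1 x + (1 - \<phi> x) * g2 x - (\<phi> y * g1 y + (1 - \<phi> y) * g2 y)
      = \<phi> x * (g1 x - g1 y) + (\<phi> x - \<phi> y) * g1 y
        + (1 - \<phi> x) * (g2 x - g2 y) - (\<phi> x - \<phi> y) * g2 y"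
    by (simp add: algebra_simps)
  ultimately have "\<bar>\<phi> x * g1 x + (1 - \<phi> x) * g2 x - (\<phi> y * g1 y + (1 - \<phi> y) * g2 y)\<bar>
      \<le> K * (M1 * \<bar>x - y\<bar>) + K * \<bar>x - y\<bar> * M1 + K * (M2 * \<bar>x - y\<bar>) + K * \<bar>x - y\<bar> * M2"
    by linarith
  then show "dist (\<phi> x * g1 x + (1 - \<phi> x) * g2 x) (\<phi> y * g1 y + (1 - \<phi> y) * g2 y)
      \<le> 2 * K * (M1 + M2) * dist x y"
    unfolding dist_real_def by (simp only: algebra_simps)
qed

text \<open>The zeros of \<open>g\<close> at the end points give \<open>g (\<phi>1 1) = 0\<close>
  and \<open>g (\<phi>2 0) = 0\<close>, so the Lipschitz constants of the compositions also bound
  their values.\<close>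

lemma T_lipschitz_on:
  assumes g: "M-lipschitz_on {0..1} g" and ends: "g 0 = 0" "g 1 = 0"
  shows "(q * M)-lipschitz_on {0..1} (T g)"
proof -
  have comp: "(M * L)-lipschitz_on {0..1} (\<lambda>x. g (h x))"
    if "L-lipschitz_on {0..1} h" "h \<in> {0..1} \<rightarrow> {0..1}" for h L
    using lipschitz_on_compose2[OF that(1) lipschitz_on_subset[OF g]] that(2) by blast
  have c1: "(M * L1)-lipschitz_on {0..1} (\<lambda>x. g (\<phi>1 x))"
    and c2: "(M * L2)-lipschitz_on {0..1} (\<lambda>x. g (\<phi>2 x))"
    using comp lip maps by blast+
  have "(2 * K * (M * L1 + M * L2))-lipschitz_on {0..1}
      (\<lambda>x. \<phi> x * g (\<phi>1 x) + (1 - \<phi> x) * g (\<phi>2 x))"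
    using c1 c2
    by (rule averaging_lipschitz_on)
      (use lipschitz_on_abs_le[OF c1, of 1] lipschitz_on_abs_le[OF c2, of 0] ends in auto)
  moreover have "2 * K * (M * L1 + M * L2) = q * M"
    by (simp add: q_def algebra_simps)
  ultimately show ?thesis
    by (simp only: T_op_def lipschitz_on_restrict)
qed

lemma T_contraction:
  assumes "f \<in> D01" "g \<in> D01" "M-lipschitz_on {0..1} (\<lambda>x. f x - g x)"
  shows "(q * M)-lipschitz_on {0..1} (\<lambda>x. T f x - T g x)"
proof -
  have "(q * M)-lipschitz_on {0..1} (T (\<lambda>x. f x - g x))"
    using assms by (intro T_lipschitz_on) (auto simp: D01_def)
  then show ?thesis
    by (simp add: lipschitz_on_def T_diff)
qed

lemma T_D01:
  assumes "f \<in> D01"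
  shows "T f \<in> D01"
proof -
  obtain M where f: "M-lipschitz_on {0..1} f"
    using assms by (auto simp: D01_iff_lipschitz_on)
  have comp: "(M * L)-lipschitz_on {0..1} (\<lambda>x. f (h x))"
    if "L-lipschitz_on {0..1} h" "h \<in> {0..1} \<rightarrow> {0..1}" for h L
    using lipschitz_on_compose2[OF that(1) lipschitz_on_subset[OF f]] that(2) by blast
  have bound: "\<bar>f x\<bar> \<le> M" if "x \<in> {0..1}" for x
    using f assms that by (intro lipschitz_on_abs_le[of _ _ 0]) (auto simp: D01_def)
  \<comment> \<open>As \<open>f 1 = 1\<close>, the sharper estimate for functions vanishing at both
    ends does not apply. Adding \<open>M\<close> gives constants that bound slopes and values alike;
    any finite constant suffices here.\<close>
  have "(2 * K * ((M * L1 + M) + (M * L2 + M)))-lipschitz_on {0..1}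
      (\<lambda>x. \<phi> x * f (\<phi>1 x) + (1 - \<phi> x) * f (\<phi>2 x))"
  proof (rule averaging_lipschitz_on)
    show "(M * L1 + M)-lipschitz_on {0..1} (\<lambda>x. f (\<phi>1 x))"
      using lipschitz_on_le[OF comp[OF lip(2) maps(1)]] lipschitz_on_nonneg[OF f] by simp
    show "(M * L2 + M)-lipschitz_on {0..1} (\<lambda>x. f (\<phi>2 x))"
      using lipschitz_on_le[OF comp[OF lip(3) maps(2)]] lipschitz_on_nonneg[OF f] by simp
    fix x :: real
    assume "x \<in> {0..1}"
    then have "\<bar>f (\<phi>1 x)\<bar> \<le> M" "\<bar>f (\<phi>2 x)\<bar> \<le> M"
      using maps by (auto intro!: bound)
    moreover have "0 \<le> M * L1" "0 \<le> M * L2"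
      using lip[THEN lipschitz_on_nonneg] lipschitz_on_nonneg[OF f] by simp_all
    ultimately show "\<bar>f (\<phi>1 x)\<bar> \<le> M * L1 + M" "\<bar>f (\<phi>2 x)\<bar> \<le> M * L2 + M"
      by simp_all
  qed
  then show ?thesis
    using assms unfolding D01_iff_lipschitz_on T_ends
    by (auto simp only: T_op_def lipschitz_on_restrict restrict_extensional)
qed

section \<open>Iterates of \<open>T\<close> and its fixed point\<close>

lemma iterate_D01: "f \<in> D01 \<Longrightarrow> (T ^^ n) f \<in> D01"
  by (induction n) (auto intro: T_D01)

lemma iterate_contraction:
  assumes "f \<in> D01" "g \<in> D01" "M-lipschitz_on {0..1} (\<lambda>x. f x - g x)"
  shows "(q ^ n * M)-lipschitz_on {0..1} (\<lambda>x. (T ^^ n) f x - (T ^^ n) g x)"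
proof (induction n)
  case (Suc n)
  from T_contraction[OF iterate_D01 iterate_D01 this] assms show ?case
    by (simp add: mult.assoc)
qed (simp add: assms)

lemma fixed_point_iterate: "T g = g \<Longrightarrow> (T ^^ n) g = g"
  by (induction n) auto

lemma iterate_tendsto_fixed_point:
  assumes "f \<in> D01" "g \<in> D01" "T g = g"
  shows "(\<lambda>n. H1_dist ((T ^^ n) f) g) \<longlonglongrightarrow> 0"
    and "x \<in> {0..1} \<Longrightarrow> (\<lambda>n. (T ^^ n) f x) \<longlonglongrightarrow> g x"
proof -
  obtain M where "M-lipschitz_on {0..1} (\<lambda>x. f x - g x)"
    using assms D01_diff_lipschitz_on by blast
  from iterate_contraction[OF assms(1,2) this]
  have lip_n: "(q ^ n * M)-lipschitz_on {0..1} (\<lambda>x. (T ^^ n) f x - g x)" for n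
    using fixed_point_iterate[OF assms(3)] by simp
  have ends: "(T ^^ n) f 0 = 0" "g 0 = 0" for n
    using iterate_D01 assms by (auto simp: D01_def)
  have lim: "(\<lambda>n. q ^ n * M) \<longlonglongrightarrow> 0"
    using q_bounds by (intro tendsto_mult_left_zero LIMSEQ_realpow_zero)
  show "(\<lambda>n. H1_dist ((T ^^ n) f) g) \<longlonglongrightarrow> 0"
    using H1_dist_nonneg[OF lip_n] H1_dist_le[OF lip_n] ends
    by (intro tendsto_sandwich[OF _ _ tendsto_const lim]) (auto intro: always_eventually)
  show "(\<lambda>n. (T ^^ n) f x) \<longlonglongrightarrow> g x" if "x \<in> {0..1}"
  proof (rule LIM_zero_cancel, rule Lim_null_comparison[OF always_eventually lim], rule allI)
    show "norm ((T ^^ n) f x - g x) \<le> q ^ n * M" for n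
      using lipschitz_on_abs_le[OF lip_n, of 0 _ x] ends that by simp
  qed
qed

text \<open>The iterates started at \<open>f\<close> are constantly \<open>f\<close>, yet converge
  pointwise to \<open>g\<close>.\<close>

lemma fixed_point_unique:
  assumes "f \<in> D01" "T f = f" "g \<in> D01" "T g = g"
  shows "f = g"
proof (rule extensionalityI)
  show "f \<in> extensional {0..1}" "g \<in> extensional {0..1}"
    using assms by (auto simp: D01_iff_lipschitz_on)
  show "f x = g x" if "x \<in> {0..1}" for x
    using iterate_tendsto_fixed_point(2)[OF assms(1,3,4) that] fixed_point_iterate[OF assms(2)]
    by (simp add: LIMSEQ_const_iff)
qed

text \<open>Successive differences are dominated by a geometric series. Working pointwise needs only
  the completeness of the reals.\<close>

lemma iterate_convergent:
  assumes "f \<in> D01" "x \<in> {0..1}"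
  shows "convergent (\<lambda>n. (T ^^ n) f x)"
proof -
  obtain M where "M-lipschitz_on {0..1} (\<lambda>x. T f x - f x)"
    using assms T_D01 D01_diff_lipschitz_on by blast
  from iterate_contraction[OF T_D01 _ this]
  have lip_n: "(q ^ n * M)-lipschitz_on {0..1} (\<lambda>x. (T ^^ Suc n) f x - (T ^^ n) f x)" for n
    using assms by (simp only: funpow_Suc_right o_apply)
  have "(T ^^ n) f 0 = 0" for n
    using iterate_D01 assms by (auto simp: D01_def)
  then have "\<bar>(T ^^ Suc n) f x - (T ^^ n) f x\<bar> \<le> q ^ n * M" for n
    using lipschitz_on_abs_le[OF lip_n, of 0 _ x] assms(2) by simp
  moreover have "summable (\<lambda>n. q ^ n * M)"
    using q_bounds by (intro summable_mult2 summable_geometric) simp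
  ultimately have "summable (\<lambda>n. (T ^^ Suc n) f x - (T ^^ n) f x)"
    by - (rule summable_comparison_test'[of _ 0], assumption, simp)
  \<comment> \<open>The partial sums telescope.\<close>
  then have "convergent (\<lambda>N. (T ^^ N) f x - f x)"
    unfolding summable_iff_convergent
      sum_lessThan_telescope[of "\<lambda>n. (T ^^ n) f x"] by simp
  then show ?thesis
    by (simp add: convergent_diff_const_right_iff)
qed

text \<open>The constant solves \<open>c = q * c + M\<close>, which is what the induction
  reproduces. Its independence of \<open>n\<close> lets it pass to the limit.\<close>

lemma iterate_diff_lipschitz_on:
  assumes "f \<in> D01" and M: "M-lipschitz_on {0..1} (\<lambda>x. T f x - f x)"
  shows "(M / (1 - q))-lipschitz_on {0..1} (\<lambda>x. (T ^^ n) f x - f x)"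
proof (induction n)
  case 0
  have "0 \<le> M / (1 - q)"
    using lipschitz_on_nonneg[OF M] q_bounds by simp
  then show ?case
    using lipschitz_on_le[OF lipschitz_on_constant] by simp
next
  case (Suc n)
  have "(q * (M / (1 - q)) + M)-lipschitz_on {0..1}
      (\<lambda>x. (T ((T ^^ n) f) x - T f x) + (T f x - f x))"
    using T_contraction[OF iterate_D01 _ Suc] assms by (intro lipschitz_on_add) auto
  moreover have "q * (M / (1 - q)) + M = M / (1 - q)"
    using q_bounds by (simp add: field_simps)
  ultimately show ?case
    by simp
qed

lemma fixed_point_exists:
  assumes f: "f \<in> D01"
  shows "\<exists>g \<in> D01. T g = g"
proof
  \<comment> \<open>The pointwise limit of the iterates, restricted so as to be extensional.\<close>
  define g where "g = (\<lambda>x\<in>{0..1}. lim (\<lambda>n. (T ^^ n) f x))"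
  have g: "(\<lambda>n. (T ^^ n) f x) \<longlonglongrightarrow> g x" if "x \<in> {0..1}" for x
    using iterate_convergent[OF f that] that by (simp add: g_def convergent_LIMSEQ_iff)
  obtain M where "M-lipschitz_on {0..1} (\<lambda>x. T f x - f x)"
    using f T_D01 D01_diff_lipschitz_on by blast
  from iterate_diff_lipschitz_on[OF f this]
  have "(M / (1 - q))-lipschitz_on {0..1} (\<lambda>x. g x - f x)"
    by (rule lipschitz_on_LIMSEQ[where f = "\<lambda>n x. (T ^^ n) f x - f x"]) (intro tendsto_diff g tendsto_const)
  moreover obtain L where "L-lipschitz_on {0..1} f"
    using f by (auto simp: D01_iff_lipschitz_on)
  ultimately have "(M / (1 - q) + L)-lipschitz_on {0..1} (\<lambda>x. (g x - f x) + f x)"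
    by (rule lipschitz_on_add)
  moreover have "(T ^^ n) f 0 = 0" "(T ^^ n) f 1 = 1" for n
    using iterate_D01[OF f] by (auto simp: D01_def)
  then have "g 0 = 0" "g 1 = 1"
    using g[of 0] g[of 1] by (simp_all add: LIMSEQ_const_iff)
  ultimately show "g \<in> D01"
    by (auto simp: D01_iff_lipschitz_on g_def)
  show "T g = g"
  proof (rule extensionalityI)
    show "T g \<in> extensional {0..1}" "g \<in> extensional {0..1}"
      by (simp_all add: g_def)
    fix x :: real
    assume x: "x \<in> {0..1}"
    then have "\<phi>1 x \<in> {0..1}" "\<phi>2 x \<in> {0..1}"
      using maps by auto
    \<comment> \<open>For fixed \<open>x\<close>, \<open>T\<close> uses its argument only at
      \<open>\<phi>1 x\<close> and \<open>\<phi>2 x\<close>, so it commutes with pointwise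
      limits.\<close>
    then have "(\<lambda>n. T ((T ^^ n) f) x) \<longlonglongrightarrow> T g x"
      unfolding T_op_def restrict_apply'[OF x] by (intro tendsto_intros g[unfolded T_op_def])
    then show "T g x = g x"
      using LIMSEQ_Suc[OF g[OF x]] LIMSEQ_unique by fastforce
  qed
qed

end

theorem theorem2:
  fixes \<phi> \<phi>1 \<phi>2 :: "real \<Rightarrow> real"
  assumes "\<phi> \<in> D01"
    and "\<phi>1 \<in> H1" and "\<phi>1 \<in> {0..1} \<rightarrow> {0..1}" and "\<phi>1 1 = 1"
    and "\<phi>2 \<in> H1" and "\<phi>2 \<in> {0..1} \<rightarrow> {0..1}" and "\<phi>2 0 = 0"
    and "H1_norm \<phi> * (H1_norm \<phi>1 - \<phi>1 0 + H1_norm \<phi>2) < 1 / 2"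
  shows "(\<exists>!fstar. fstar \<in> D01 \<and> T_op \<phi> \<phi>1 \<phi>2 fstar = fstar) \<and>
    (\<forall>fstar \<in> D01. T_op \<phi> \<phi>1 \<phi>2 fstar = fstar \<longrightarrow>
      (\<forall>f :: nat \<Rightarrow> real \<Rightarrow> real.
        f 0 \<in> D01 \<and> (\<forall>n\<ge>1. f n = T_op \<phi> \<phi>1 \<phi>2 (f (n - 1))) \<longrightarrow>
        (\<forall>n. f n \<in> D01) \<and> (\<lambda>n. H1_dist (f n) fstar) \<longlonglongrightarrow> 0))"
proof -
  have phi: "\<phi> \<in> H1" "\<phi> 0 = 0" "\<phi> 1 = 1"
    using assms(1) by (auto simp: D01_def)
  have "0 \<le> \<phi>1 0"
    using assms(3) by (auto simp: Pi_iff)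
  \<comment> \<open>As \<open>\<phi> 0 = 0\<close>, \<open>\<phi>2 0 = 0\<close> and
    \<open>\<phi>1 0\<close> is nonnegative, the norm condition is exactly \<open>small\<close> for
    these suprema.\<close>
  then interpret averaging_operator \<phi> \<phi>1 \<phi>2
    "Sup (diff_quotients \<phi>)" "Sup (diff_quotients \<phi>1)" "Sup (diff_quotients \<phi>2)"
    using assms phi by unfold_locales (simp_all add: H1_lipschitz_on H1_norm_def)
  have iterate: "f n = (T ^^ n) (f 0)" if "\<forall>n\<ge>1. f n = T (f (n - 1))" for f n
    by (induction n) (use that in auto)
  show ?thesis
  proof (intro conjI ballI impI allI)
    show "\<exists>!fstar. fstar \<in> D01 \<and> T fstar = fstar"
      \<comment> \<open>\<open>\<phi>\<close> itself lies in \<open>D01\<close> and serves as the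
        starting point.\<close>
      using fixed_point_exists[OF assms(1)] fixed_point_unique by blast
    fix fstar and f :: "nat \<Rightarrow> real \<Rightarrow> real"
    assume fstar: "fstar \<in> D01" "T fstar = fstar"
      and f: "f 0 \<in> D01 \<and> (\<forall>n\<ge>1. f n = T (f (n - 1)))"
    have f_iterate: "(T ^^ n) (f 0) = f n" for n
      by (rule iterate[symmetric]) (rule conjunct2[OF f])
    show "f n \<in> D01" for n
      using iterate_D01[of "f 0" n] f by (simp only: f_iterate)
    show "(\<lambda>n. H1_dist (f n) fstar) \<longlonglongrightarrow> 0"
      using iterate_tendsto_fixed_point(1)[of "f 0" fstar] fstar f by (simp only: f_iterate)
  qed
qed

end
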